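(* Let $G$ be a finite group, $k$ an infinite field and $V$ a cyclic left $kG$-module. Then the set of generic points of $V$ is non-empty and open in $V$ in the Zariski topology. In particular, there are generic points.
   Context: $\operatorname{Gens}(V)=\{v\in V : V=kGv\}$, where $kGv$ is the $k$-span of the orbit $Gv$; $V$ is cyclic if $\operatorname{Gens}(V)\neq\emptyset$ (then $V$ is finite-dimensional). For $v\in V$, $\operatorname{Sym}(G,v)$ is the set of permutations $\pi$ of the set $G$ for which there is $A\in\operatorname{GL}(V)$ with $A(gv)=\pi(g)v$ for all $g\in G$; $\operatorname{Sym}(G,V)=\bigcap_{v\in\operatorname{Gens}(V)}\operatorname{Sym}(G,v)$. Let $\operatorname{Ker}(V)=\{g\in G: gv=v\text{ for all }v\in V\}$ and $G_v=\{g\in G: gv=v\}$. A point $v\in V$ is called generic if $v\in\operatorname{Gens}(V)$, $G_v=\operatorname{Ker}(V)$ and $\operatorname{Sym}(G,v)=\operatorname{Sym}(G,V)$. The Zariski topology on $V\cong k^d$ has as closed sets the zero sets of families of polynomials in $k[X_1,\dots,X_d]$. *)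

theory Defs
  imports
    "HOL-Analysis.Abstract_Topology"
    "HOL-Algebra.Group_Action"
    "HOL-Combinatorics.Permutations"
    "HOL-Library.Poly_Mapping"
begin

section \<open>Polynomials in finitely many variables\<close>

text \<open>
  A polynomial is a finitely supported map from monomials to coefficients, and a monomial is a
  finitely supported map from variable indices to exponents.  The set \<open>mpoly_ring n\<close> is
  $k[X_0, \dots, X_{n-1}]$; the variables are numbered from 0.
\<close>

type_synonym 'k mpoly = "(nat \<Rightarrow>\<^sub>0 nat) \<Rightarrow>\<^sub>0 'k"

definition mpoly_ring :: "nat \<Rightarrow> 'k::comm_ring_1 mpoly set" where
  "mpoly_ring n = {p. \<forall>m \<in> Poly_Mapping.keys p. Poly_Mapping.keys m \<subseteq> {..<n}}"

definition mono_eval :: "(nat \<Rightarrow> 'k::comm_ring_1) \<Rightarrow> (nat \<Rightarrow>\<^sub>0 nat) \<Rightarrow> 'k" where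
  "mono_eval x m = (\<Prod>i \<in> Poly_Mapping.keys m. x i ^ Poly_Mapping.lookup m i)"

definition mpoly_eval :: "(nat \<Rightarrow> 'k::comm_ring_1) \<Rightarrow> 'k mpoly \<Rightarrow> 'k" where
  "mpoly_eval x p = (\<Sum>m \<in> Poly_Mapping.keys p. Poly_Mapping.lookup p m * mono_eval x m)"

lemma mono_eval_superset:
  assumes "finite S" "Poly_Mapping.keys m \<subseteq> S"
  shows "mono_eval x m = (\<Prod>i \<in> S. x i ^ Poly_Mapping.lookup m i)"
  unfolding mono_eval_def
  by (rule prod.mono_neutral_left) (use assms in \<open>auto simp: in_keys_iff\<close>)

lemma mono_eval_add: "mono_eval x (a + b) = mono_eval x a * mono_eval x b"
proof -
  let ?S = "Poly_Mapping.keys a \<union> Poly_Mapping.keys b"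
  have "mono_eval x (a + b) = (\<Prod>i \<in> ?S. x i ^ Poly_Mapping.lookup (a + b) i)"
    by (rule mono_eval_superset) (auto dest: subsetD[OF Poly_Mapping.keys_add])
  moreover have "mono_eval x a = (\<Prod>i \<in> ?S. x i ^ Poly_Mapping.lookup a i)"
    by (rule mono_eval_superset) auto
  moreover have "mono_eval x b = (\<Prod>i \<in> ?S. x i ^ Poly_Mapping.lookup b i)"
    by (rule mono_eval_superset) auto
  ultimately show ?thesis
    by (simp add: lookup_add power_add prod.distrib)
qed

lemma mpoly_eval_superset:
  assumes "finite S" "Poly_Mapping.keys p \<subseteq> S"
  shows "mpoly_eval x p = (\<Sum>m \<in> S. Poly_Mapping.lookup p m * mono_eval x m)"
  unfolding mpoly_eval_def
  by (rule sum.mono_neutral_left) (use assms in \<open>auto simp: in_keys_iff\<close>)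

lemma mpoly_eval_0 [simp]: "mpoly_eval x 0 = 0"
  by (simp add: mpoly_eval_def)

lemma mpoly_eval_add: "mpoly_eval x (p + q) = mpoly_eval x p + mpoly_eval x q"
proof -
  let ?S = "Poly_Mapping.keys p \<union> Poly_Mapping.keys q"
  have "mpoly_eval x (p + q) = (\<Sum>m \<in> ?S. Poly_Mapping.lookup (p + q) m * mono_eval x m)"
    by (rule mpoly_eval_superset) (auto dest: subsetD[OF Poly_Mapping.keys_add])
  moreover have "mpoly_eval x p = (\<Sum>m \<in> ?S. Poly_Mapping.lookup p m * mono_eval x m)"
    by (rule mpoly_eval_superset) auto
  moreover have "mpoly_eval x q = (\<Sum>m \<in> ?S. Poly_Mapping.lookup q m * mono_eval x m)"
    by (rule mpoly_eval_superset) auto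
  ultimately show ?thesis
    by (simp add: lookup_add distrib_right sum.distrib)
qed

lemma mpoly_eval_sum: "mpoly_eval x (sum f A) = (\<Sum>a \<in> A. mpoly_eval x (f a))"
  by (induction A rule: infinite_finite_induct) (auto simp: mpoly_eval_add)

lemma mpoly_eval_single: "mpoly_eval x (Poly_Mapping.single m c) = c * mono_eval x m"
  by (simp add: mpoly_eval_def)

lemma mpoly_expand:
  "(p :: 'k::comm_ring_1 mpoly) =
     (\<Sum>m \<in> Poly_Mapping.keys p. Poly_Mapping.single m (Poly_Mapping.lookup p m))"
  by (rule poly_mapping_eqI)
     (auto simp: lookup_sum lookup_single when_def in_keys_iff)

lemma mpoly_eval_mult: "mpoly_eval x (p * q) = mpoly_eval x p * mpoly_eval x q"
proof -
  let ?P = "Poly_Mapping.keys p" and ?Q = "Poly_Mapping.keys q"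
  let ?s = "\<lambda>r m. Poly_Mapping.single m (Poly_Mapping.lookup r m)"
  have "p * q = (\<Sum>a \<in> ?P. ?s p a) * (\<Sum>b \<in> ?Q. ?s q b)"
    by (rule arg_cong2[OF mpoly_expand mpoly_expand])
  also have "\<dots> = (\<Sum>a \<in> ?P. \<Sum>b \<in> ?Q. ?s p a * ?s q b)"
    by (simp add: sum_product)
  finally have "mpoly_eval x (p * q) = (\<Sum>a \<in> ?P. \<Sum>b \<in> ?Q. mpoly_eval x (?s p a * ?s q b))"
    by (simp add: mpoly_eval_sum)
  also have "\<dots> = (\<Sum>a \<in> ?P. \<Sum>b \<in> ?Q.
      (Poly_Mapping.lookup p a * mono_eval x a) * (Poly_Mapping.lookup q b * mono_eval x b))"
    by (simp add: mult_single mpoly_eval_single mono_eval_add mult_ac)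
  also have "\<dots> = mpoly_eval x p * mpoly_eval x q"
    by (simp add: sum_product mpoly_eval_def)
  finally show ?thesis .
qed

lemma mpoly_ring_add: "p \<in> mpoly_ring n \<Longrightarrow> q \<in> mpoly_ring n \<Longrightarrow> p + q \<in> mpoly_ring n"
  unfolding mpoly_ring_def using Poly_Mapping.keys_add[of p q] by blast

lemma mpoly_ring_mult:
  assumes "p \<in> mpoly_ring n" "q \<in> mpoly_ring n"
  shows "p * q \<in> mpoly_ring n"
proof -
  have "Poly_Mapping.keys m \<subseteq> {..<n}" if m: "m \<in> Poly_Mapping.keys (p * q)" for m
  proof -
    obtain a b where "m = a + b" "a \<in> Poly_Mapping.keys p" "b \<in> Poly_Mapping.keys q"
      using m keys_mult[of p q] by blast
    then show ?thesis
      using assms Poly_Mapping.keys_add[of a b] unfolding mpoly_ring_def by blast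
  qed
  then show ?thesis by (simp add: mpoly_ring_def)
qed

section \<open>The Zariski topology on a vector space\<close>

text \<open>
  This locale is just \<open>vector_space\<close>; a separate name avoids exporting the constants below
  to the global interpretations of \<open>vector_space\<close>.
\<close>

locale zariski_vector_space = vector_space scale
  for scale :: "'a::field \<Rightarrow> 'b::ab_group_add \<Rightarrow> 'b" (infixr \<open>*s\<close> 75)
begin

definition ordered_basis :: "'b list \<Rightarrow> bool" where
  "ordered_basis bs \<longleftrightarrow> distinct bs \<and> independent (set bs) \<and> span (set bs) = UNIV"

definition coord :: "'b list \<Rightarrow> 'b \<Rightarrow> nat \<Rightarrow> 'a" where
  "coord bs v i = representation (set bs) v (bs ! i)"

definition zariski_closed_wrt :: "'b list \<Rightarrow> 'b set \<Rightarrow> bool" where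
  "zariski_closed_wrt bs C \<longleftrightarrow>
     (\<exists>P \<subseteq> mpoly_ring (length bs). C = {v. \<forall>p \<in> P. mpoly_eval (coord bs v) p = 0})"

text \<open>
  We ask for closedness in the coordinates of every ordered basis; by
  \<open>closedin_zariski_topology_iff\<close> below, one ordered basis suffices.  This is only meaningful
  when $V$ has a finite basis.
\<close>

definition zariski_topology :: "'b topology" where
  "zariski_topology = topology (\<lambda>U. \<forall>bs. ordered_basis bs \<longrightarrow> zariski_closed_wrt bs (- U))"

lemma zariski_closed_wrt_Un:
  assumes "zariski_closed_wrt bs A" "zariski_closed_wrt bs B"
  shows "zariski_closed_wrt bs (A \<union> B)"
proof -
  obtain P where P: "P \<subseteq> mpoly_ring (length bs)"
    "A = {v. \<forall>p \<in> P. mpoly_eval (coord bs v) p = 0}"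
    using assms(1) unfolding zariski_closed_wrt_def by blast
  obtain Q where Q: "Q \<subseteq> mpoly_ring (length bs)"
    "B = {v. \<forall>p \<in> Q. mpoly_eval (coord bs v) p = 0}"
    using assms(2) unfolding zariski_closed_wrt_def by blast
  let ?R = "{p * q | p q. p \<in> P \<and> q \<in> Q}"
  have "?R \<subseteq> mpoly_ring (length bs)"
    using P(1) Q(1) mpoly_ring_mult by blast
  moreover have "A \<union> B = {v. \<forall>r \<in> ?R. mpoly_eval (coord bs v) r = 0}"
  proof (intro Set.set_eqI iffI)
    fix v assume "v \<in> A \<union> B"
    then show "v \<in> {v. \<forall>r \<in> ?R. mpoly_eval (coord bs v) r = 0}"
      using P(2) Q(2) by (auto simp: mpoly_eval_mult)
  next
    fix v assume v: "v \<in> {v. \<forall>r \<in> ?R. mpoly_eval (coord bs v) r = 0}"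
    show "v \<in> A \<union> B"
    proof (rule ccontr)
      assume "v \<notin> A \<union> B"
      then obtain p q where "p \<in> P" "q \<in> Q"
        "mpoly_eval (coord bs v) p \<noteq> 0" "mpoly_eval (coord bs v) q \<noteq> 0"
        using P(2) Q(2) by blast
      moreover have "mpoly_eval (coord bs v) (p * q) = 0"
        using v \<open>p \<in> P\<close> \<open>q \<in> Q\<close> by blast
      ultimately show False by (simp add: mpoly_eval_mult)
    qed
  qed
  ultimately show ?thesis unfolding zariski_closed_wrt_def by blast
qed

lemma zariski_closed_wrt_Inter:
  assumes "\<And>C. C \<in> K \<Longrightarrow> zariski_closed_wrt bs C"
  shows "zariski_closed_wrt bs (\<Inter>K)"
proof -
  have "\<forall>C\<in>K. \<exists>P. P \<subseteq> mpoly_ring (length bs) \<and>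
      C = {v. \<forall>p \<in> P. mpoly_eval (coord bs v) p = 0}"
    using assms unfolding zariski_closed_wrt_def by blast
  then obtain P where P: "\<forall>C\<in>K. P C \<subseteq> mpoly_ring (length bs) \<and>
      C = {v. \<forall>p \<in> P C. mpoly_eval (coord bs v) p = 0}"
    by (rule bchoice[THEN exE])
  have "v \<in> \<Inter>K \<longleftrightarrow> (\<forall>p \<in> (\<Union>C\<in>K. P C). mpoly_eval (coord bs v) p = 0)" for v
  proof -
    have "v \<in> C \<longleftrightarrow> (\<forall>p \<in> P C. mpoly_eval (coord bs v) p = 0)" if "C \<in> K" for C
      using P that by blast
    then show ?thesis by blast
  qed
  then have "\<Inter>K = {v. \<forall>p \<in> (\<Union>C\<in>K. P C). mpoly_eval (coord bs v) p = 0}"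
    by blast
  moreover have "(\<Union>C\<in>K. P C) \<subseteq> mpoly_ring (length bs)"
    using P by blast
  ultimately show ?thesis unfolding zariski_closed_wrt_def by blast
qed

lemma istopology_zariski:
  "istopology (\<lambda>U. \<forall>bs. ordered_basis bs \<longrightarrow> zariski_closed_wrt bs (- U))"
  unfolding istopology_def
proof (intro conjI allI impI)
  fix S T bs
  assume "\<forall>bs. ordered_basis bs \<longrightarrow> zariski_closed_wrt bs (- S)"
    "\<forall>bs. ordered_basis bs \<longrightarrow> zariski_closed_wrt bs (- T)" "ordered_basis bs"
  then show "zariski_closed_wrt bs (- (S \<inter> T))"
    using zariski_closed_wrt_Un[of bs "- S" "- T"] by simp
next
  fix \<K> bs
  assume *: "\<forall>K\<in>\<K>. \<forall>bs. ordered_basis bs \<longrightarrow> zariski_closed_wrt bs (- K)" "ordered_basis bs"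
  have "zariski_closed_wrt bs (\<Inter> (uminus ` \<K>))"
    by (rule zariski_closed_wrt_Inter) (use * in blast)
  moreover have "\<Inter> (uminus ` \<K>) = - \<Union>\<K>" by auto
  ultimately show "zariski_closed_wrt bs (- \<Union>\<K>)" by simp
qed

lemma openin_zariski_topology:
  "openin zariski_topology U \<longleftrightarrow> (\<forall>bs. ordered_basis bs \<longrightarrow> zariski_closed_wrt bs (- U))"
  unfolding zariski_topology_def by (simp add: topology_inverse'[OF istopology_zariski])

lemma zariski_closed_wrt_empty: "zariski_closed_wrt bs {}"
proof -
  have "mpoly_eval x 1 = (1 :: 'a)" for x
    using mpoly_eval_single[of x 0 1] by (simp add: mono_eval_def)
  then show ?thesis
    unfolding zariski_closed_wrt_def by (intro exI[of _ "{1}"]) (simp add: mpoly_ring_def)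
qed

lemma topspace_zariski_topology [simp]: "topspace zariski_topology = UNIV"
proof -
  have "openin zariski_topology UNIV"
    by (simp add: openin_zariski_topology zariski_closed_wrt_empty)
  then show ?thesis using openin_subset by blast
qed

lemma closedin_zariski_topology:
  "closedin zariski_topology C \<longleftrightarrow> (\<forall>bs. ordered_basis bs \<longrightarrow> zariski_closed_wrt bs C)"
  by (simp add: closedin_def openin_zariski_topology flip: Compl_eq_Diff_UNIV)

definition polynomial_fun :: "'b list \<Rightarrow> ('b \<Rightarrow> 'a) \<Rightarrow> bool" where
  "polynomial_fun bs f \<longleftrightarrow>
     (\<exists>p \<in> mpoly_ring (length bs). \<forall>v. f v = mpoly_eval (coord bs v) p)"

lemma polynomial_fun_const: "polynomial_fun bs (\<lambda>v. c)"
  unfolding polynomial_fun_def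
  by (intro bexI[of _ "Poly_Mapping.single 0 c"])
     (auto simp: mpoly_eval_single mono_eval_def mpoly_ring_def)

lemma polynomial_fun_coord: "i < length bs \<Longrightarrow> polynomial_fun bs (\<lambda>v. coord bs v i)"
  unfolding polynomial_fun_def
  by (intro bexI[of _ "Poly_Mapping.single (Poly_Mapping.single i 1) 1"])
     (auto simp: mpoly_eval_single mono_eval_def mpoly_ring_def)

lemma polynomial_fun_add:
  assumes "polynomial_fun bs f" "polynomial_fun bs g"
  shows "polynomial_fun bs (\<lambda>v. f v + g v)"
proof -
  obtain p q where "p \<in> mpoly_ring (length bs)" "\<forall>v. f v = mpoly_eval (coord bs v) p"
    "q \<in> mpoly_ring (length bs)" "\<forall>v. g v = mpoly_eval (coord bs v) q"
    using assms unfolding polynomial_fun_def by blast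
  then show ?thesis
    unfolding polynomial_fun_def
    by (intro bexI[of _ "p + q"]) (auto simp: mpoly_eval_add mpoly_ring_add)
qed

lemma polynomial_fun_mult:
  assumes "polynomial_fun bs f" "polynomial_fun bs g"
  shows "polynomial_fun bs (\<lambda>v. f v * g v)"
proof -
  obtain p q where "p \<in> mpoly_ring (length bs)" "\<forall>v. f v = mpoly_eval (coord bs v) p"
    "q \<in> mpoly_ring (length bs)" "\<forall>v. g v = mpoly_eval (coord bs v) q"
    using assms unfolding polynomial_fun_def by blast
  then show ?thesis
    unfolding polynomial_fun_def
    by (intro bexI[of _ "p * q"]) (auto simp: mpoly_eval_mult mpoly_ring_mult)
qed

lemma polynomial_fun_sum:
  assumes "\<And>a. a \<in> A \<Longrightarrow> polynomial_fun bs (f a)"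
  shows "polynomial_fun bs (\<lambda>v. \<Sum>a\<in>A. f a v)"
  using assms
  by (induction A rule: infinite_finite_induct)
     (auto intro: polynomial_fun_add polynomial_fun_const)

lemma polynomial_fun_prod:
  assumes "\<And>a. a \<in> A \<Longrightarrow> polynomial_fun bs (f a)"
  shows "polynomial_fun bs (\<lambda>v. \<Prod>a\<in>A. f a v)"
  using assms
  by (induction A rule: infinite_finite_induct)
     (auto intro: polynomial_fun_mult polynomial_fun_const)

lemma polynomial_fun_power: "polynomial_fun bs f \<Longrightarrow> polynomial_fun bs (\<lambda>v. f v ^ n)"
  by (induction n) (auto intro: polynomial_fun_mult polynomial_fun_const)

lemma coord_expand:
  assumes "ordered_basis bs"
  shows "(\<Sum>i<length bs. coord bs v i *s (bs ! i)) = v"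
proof -
  have "(\<Sum>i<length bs. coord bs v i *s (bs ! i)) =
      (\<Sum>b\<in>set bs. representation (set bs) v b *s b)"
    unfolding coord_def using assms
    by (intro sum.reindex_bij_betw bij_betw_nth) (auto simp: ordered_basis_def)
  also have "\<dots> = v"
    by (rule sum_representation_eq) (use assms in \<open>auto simp: ordered_basis_def\<close>)
  finally show ?thesis .
qed

lemma coord_change:
  assumes "ordered_basis bs" "ordered_basis cs"
  shows "coord cs v j = (\<Sum>i<length bs. coord bs v i * coord cs (bs ! i) j)"
proof -
  have cs: "independent (set cs)" "\<And>w. w \<in> span (set cs)"
    using assms(2) by (auto simp: ordered_basis_def)
  have "coord cs v j = coord cs (\<Sum>i<length bs. coord bs v i *s (bs ! i)) j"
    by (simp add: coord_expand[OF assms(1)])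
  also have "\<dots> = (\<Sum>i<length bs. coord bs v i * coord cs (bs ! i) j)"
    unfolding coord_def[of cs]
    by (simp add: representation_sum[OF cs(1) cs(2)] representation_scale[OF cs(1) cs(2)])
  finally show ?thesis .
qed

lemma polynomial_fun_change_basis:
  assumes "ordered_basis bs" "ordered_basis cs" "polynomial_fun cs f"
  shows "polynomial_fun bs f"
proof -
  obtain p where p: "f = (\<lambda>v. mpoly_eval (coord cs v) p)"
    using assms(3) unfolding polynomial_fun_def by blast
  have *: "polynomial_fun bs (\<lambda>v. coord cs v j)" for j
  proof -
    have "polynomial_fun bs (\<lambda>v. \<Sum>i<length bs. coord bs v i * coord cs (bs ! i) j)"
      by (rule polynomial_fun_sum)
         (simp add: polynomial_fun_mult polynomial_fun_coord polynomial_fun_const)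
    moreover have "(\<lambda>v. coord cs v j) = (\<lambda>v. \<Sum>i<length bs. coord bs v i * coord cs (bs ! i) j)"
      by (rule ext, rule coord_change[OF assms(1,2)])
    ultimately show ?thesis by simp
  qed
  show ?thesis
    unfolding p mpoly_eval_def mono_eval_def
    by (rule polynomial_fun_sum)
       (rule polynomial_fun_mult[OF polynomial_fun_const
          polynomial_fun_prod[OF polynomial_fun_power[OF *]]])
qed

lemma zariski_closed_wrt_iff_polynomial_fun:
  "zariski_closed_wrt bs C \<longleftrightarrow> (\<exists>F \<subseteq> Collect (polynomial_fun bs). C = {v. \<forall>f \<in> F. f v = 0})"
proof
  assume "zariski_closed_wrt bs C"
  then obtain P where "P \<subseteq> mpoly_ring (length bs)"
    "C = {v. \<forall>p \<in> P. mpoly_eval (coord bs v) p = 0}"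
    unfolding zariski_closed_wrt_def by blast
  note P = this
  let ?F = "(\<lambda>p v. mpoly_eval (coord bs v) p) ` P"
  have "?F \<subseteq> Collect (polynomial_fun bs)"
  proof (intro image_subsetI CollectI)
    fix p assume "p \<in> P"
    then show "polynomial_fun bs (\<lambda>v. mpoly_eval (coord bs v) p)"
      unfolding polynomial_fun_def using P(1) by (intro bexI[of _ p]) (simp_all add: subset_iff)
  qed
  moreover have "C = {v. \<forall>f \<in> ?F. f v = 0}"
    unfolding P(2) by (simp only: ball_simps)
  ultimately show "\<exists>F \<subseteq> Collect (polynomial_fun bs). C = {v. \<forall>f \<in> F. f v = 0}"
    by (intro exI[of _ ?F] conjI)
next
  assume "\<exists>F \<subseteq> Collect (polynomial_fun bs). C = {v. \<forall>f \<in> F. f v = 0}"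
  then obtain F where F: "F \<subseteq> Collect (polynomial_fun bs)" "C = {v. \<forall>f \<in> F. f v = 0}"
    by blast
  have "\<forall>f\<in>F. \<exists>p. p \<in> mpoly_ring (length bs) \<and> (\<forall>v. f v = mpoly_eval (coord bs v) p)"
    using F(1) unfolding polynomial_fun_def by blast
  then obtain p where "\<forall>f\<in>F. p f \<in> mpoly_ring (length bs) \<and>
      (\<forall>v. f v = mpoly_eval (coord bs v) (p f))"
    by (rule bchoice[THEN exE])
  then show "zariski_closed_wrt bs C"
    unfolding zariski_closed_wrt_def F(2) by (intro exI[of _ "p ` F"]) auto
qed

theorem closedin_zariski_topology_iff:
  assumes "ordered_basis bs"
  shows "closedin zariski_topology C \<longleftrightarrow> zariski_closed_wrt bs C"
proof -
  have "zariski_closed_wrt cs C \<longleftrightarrow> zariski_closed_wrt bs C" if "ordered_basis cs" for cs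
  proof -
    have "polynomial_fun cs = polynomial_fun bs"
      using polynomial_fun_change_basis assms that by blast
    then show ?thesis by (simp add: zariski_closed_wrt_iff_polynomial_fun)
  qed
  then show ?thesis
    unfolding closedin_zariski_topology using assms by blast
qed

end

section \<open>Modules over a group algebra and generic points\<close>

text \<open>
  A left $kG$-module is a $k$-vector space with a $k$-linear action of $G$ on it.
\<close>

locale kG_module =
  group_action G "UNIV :: 'v set" act + zariski_vector_space scale
  for G :: "('g, 'm) monoid_scheme" (structure)
    and scale :: "'k::field \<Rightarrow> 'v::ab_group_add \<Rightarrow> 'v"
    and act :: "'g \<Rightarrow> 'v \<Rightarrow> 'v" +
  assumes linear_act: "g \<in> carrier G \<Longrightarrow> Vector_Spaces.linear scale scale (act g)"
begin

definition Gens :: "'v set" where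
  "Gens = {v. span (orbit G act v) = UNIV}"

definition cyclic :: bool where
  "cyclic \<longleftrightarrow> Gens \<noteq> {}"

definition Sym_at :: "'v \<Rightarrow> ('g \<Rightarrow> 'g) set" where
  "Sym_at v = {\<pi>. \<pi> permutes carrier G \<and>
     (\<exists>A. Vector_Spaces.linear scale scale A \<and> bij A \<and>
          (\<forall>g \<in> carrier G. A (act g v) = act (\<pi> g) v))}"

definition Sym :: "('g \<Rightarrow> 'g) set" where
  "Sym = (\<Inter>v \<in> Gens. Sym_at v)"

definition Ker :: "'g set" where
  "Ker = {g \<in> carrier G. \<forall>v. act g v = v}"

definition generic :: "'v \<Rightarrow> bool" where
  "generic v \<longleftrightarrow> v \<in> Gens \<and> stabilizer G act v = Ker \<and> Sym_at v = Sym"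

lemma ordered_basis_exists:
  assumes "finite (carrier G)" "cyclic"
  shows "\<exists>bs. ordered_basis bs"
proof -
  obtain v where v: "span (orbit G act v) = UNIV"
    using assms(2) unfolding cyclic_def Gens_def by blast
  have "orbit G act v = (\<lambda>g. act g v) ` carrier G"
    unfolding orbit_def by blast
  then have fin: "finite (orbit G act v)" using assms(1) by simp
  obtain B where B: "B \<subseteq> orbit G act v" "independent B" "orbit G act v \<subseteq> span B"
    by (rule maximal_independent_subset[of "orbit G act v"])
  have "span (orbit G act v) \<subseteq> span B"
    by (rule span_minimal[OF B(3) subspace_span])
  then have "span B = UNIV" using v by auto
  obtain bs where "set bs = B" "distinct bs"
    using finite_distinct_list[OF finite_subset[OF B(1) fin]] by blast
  then show ?thesis using B \<open>span B = UNIV\<close> by (auto simp: ordered_basis_def)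
qed

end

end

theory Submission
  imports Defs "Jordan_Normal_Form.Determinant"
begin

text \<open>
  The generic points are the intersection of finitely many sets: \<open>Gens\<close>, the sets
  $\{v : gv \neq v\}$ for $g \notin \mathrm{Ker}(V)$, and the sets
  $\{v \in \mathrm{Gens}(V) : \pi \notin \mathrm{Sym}(G, v)\}$ for
  $\pi \notin \mathrm{Sym}(G, V)$.  Each is non-empty, so it suffices that each is open and that
  non-empty open sets meet.  Any two do: on the line through a point of each, the defining
  polynomials become nonzero polynomials in one variable, whose product has a non-root in the
  infinite field $k$.  Openness comes from minors: $v$ is a generator iff some $d \times d$
  determinant with rows $h_r v$ is nonzero, and for such $v$ the permutation $\pi$ is not a
  symmetry iff the $k$-span of the pairs $(gv, \pi(g)v)$ has dimension greater than $d$, which is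
  seen by bordering such a determinant with one coordinate of the vectors $\pi(h_r)v$.
\<close>

section \<open>Determinants and linear dependence\<close>

text \<open>The kernel vector is a function \<open>c\<close> on indices, so later arguments use
  plain finite sums over coordinates rather than matrix and vector types.\<close>

lemma det_eq_0_iff_right_kernel:
  fixes a :: "nat \<Rightarrow> nat \<Rightarrow> 'a::field"
  shows "det (mat n n (\<lambda>(i, j). a i j)) = 0 \<longleftrightarrow>
    (\<exists>c. (\<exists>j<n. c j \<noteq> 0) \<and> (\<forall>i<n. (\<Sum>j<n. a i j * c j) = 0))"
    (is "det ?A = 0 \<longleftrightarrow> ?R")
proof -
  have A: "?A \<in> carrier_mat n n" by simp
  have mv: "?A *\<^sub>v vec n c = 0\<^sub>v n \<longleftrightarrow> (\<forall>i<n. (\<Sum>j<n. a i j * c j) = 0)" for c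
    by (auto simp: vec_eq_iff scalar_prod_def atLeast0LessThan)
  have nz: "vec n c \<noteq> 0\<^sub>v n \<longleftrightarrow> (\<exists>j<n. c j \<noteq> 0)" for c :: "nat \<Rightarrow> 'a"
    by (auto simp: vec_eq_iff)
  \<comment> \<open>Every vector of dimension \<open>n\<close> has the form \<open>vec n c\<close>,
    so a quantifier over vectors turns into one over functions.\<close>
  have ex: "(\<exists>v. v \<in> carrier_vec n \<and> P v) \<longleftrightarrow> (\<exists>c. P (vec n c))" for P :: "'a vec \<Rightarrow> bool"
    by (metis carrier_vecD dim_vec eq_vecI index_vec vec_carrier)
  show ?thesis
    unfolding det_0_iff_vec_prod_zero_field[OF A] ex mv nz ..
qed

text \<open>Transposition reduces this to the right kernel. A left kernel vector is a linear
  relation between the rows, which later hold the coordinates of vectors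
  \<open>act (h r) v\<close>.\<close>

lemma det_eq_0_iff_left_kernel:
  fixes a :: "nat \<Rightarrow> nat \<Rightarrow> 'a::field"
  shows "det (mat n n (\<lambda>(i, j). a i j)) = 0 \<longleftrightarrow>
    (\<exists>c. (\<exists>i<n. c i \<noteq> 0) \<and> (\<forall>j<n. (\<Sum>i<n. c i * a i j) = 0))"
proof -
  have "det (mat n n (\<lambda>(i, j). a i j)) = det (transpose_mat (mat n n (\<lambda>(i, j). a i j)))"
    by (rule det_transpose[symmetric, of _ n]) simp
  also have "transpose_mat (mat n n (\<lambda>(i, j). a i j)) = mat n n (\<lambda>(i, j). a j i)"
    by (rule eq_matI) auto
  finally show ?thesis
    by (simp add: det_eq_0_iff_right_kernel mult.commute)
qed

text \<open>Row \<open>i\<close> of the inverse matrix lists the coefficients that combine the rows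
  of \<open>a\<close> to the \<open>i\<close>-th unit vector; this serves to recover basis vectors
  from an orbit.\<close>

lemma left_inverse_if_det_neq_0:
  fixes a :: "nat \<Rightarrow> nat \<Rightarrow> 'a::field"
  assumes "det (mat n n (\<lambda>(i, j). a i j)) \<noteq> 0"
  obtains b where "\<And>i j. i < n \<Longrightarrow> j < n \<Longrightarrow> (\<Sum>r<n. b i r * a r j) = (if i = j then 1 else 0)"
proof -
  let ?A = "mat n n (\<lambda>(i, j). a i j)"
  have "?A \<in> Units (ring_mat TYPE('a) n ())"
    by (rule det_non_zero_imp_unit) (use assms in auto)
  then obtain B where B: "B \<in> carrier_mat n n" "B * ?A = 1\<^sub>m n"
    by (auto simp: Units_def ring_mat_def)
  show thesis
  proof
    fix i j assume ij: "i < n" "j < n"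
    have "(\<Sum>r<n. B $$ (i, r) * a r j) = (B * ?A) $$ (i, j)"
      using ij B(1) by (simp add: scalar_prod_def atLeast0LessThan)
    then show "(\<Sum>r<n. B $$ (i, r) * a r j) = (if i = j then 1 else 0)"
      using ij by (simp add: B(2))
  qed
qed

section \<open>Open sets in the Zariski topology\<close>

context zariski_vector_space
begin

section \<open>Coordinates with respect to an ordered basis\<close>

lemma ordered_basisD:
  assumes "ordered_basis bs"
  shows "distinct bs" "independent (set bs)" "v \<in> span (set bs)"
  using assms by (auto simp: ordered_basis_def)

lemma coord_sum:
  assumes "ordered_basis bs"
  shows "coord bs (\<Sum>a\<in>A. f a) i = (\<Sum>a\<in>A. coord bs (f a) i)"
  unfolding coord_def by (simp add: representation_sum ordered_basisD[OF assms])

lemma coord_scale: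
  assumes "ordered_basis bs"
  shows "coord bs (c *s v) i = c * coord bs v i"
  unfolding coord_def by (simp add: representation_scale ordered_basisD[OF assms])

lemma coord_add:
  assumes "ordered_basis bs"
  shows "coord bs (u + v) i = coord bs u i + coord bs v i"
  unfolding coord_def by (simp add: representation_add ordered_basisD[OF assms])

lemma coord_basis:
  assumes "ordered_basis bs" "i < length bs" "j < length bs"
  shows "coord bs (bs ! i) j = (if i = j then 1 else 0)"
  unfolding coord_def using assms(2,3) ordered_basisD(1)[OF assms(1)]
  by (simp add: representation_basis ordered_basisD(2)[OF assms(1)] nth_eq_iff_index_eq)

lemma coord_0: "ordered_basis bs \<Longrightarrow> coord bs 0 i = 0"
  using coord_scale[of bs 0 0 i] by simp

lemma vector_eqI_coord:
  assumes "ordered_basis bs" "\<And>i. i < length bs \<Longrightarrow> coord bs u i = coord bs v i"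
  shows "u = v"
proof -
  have "(\<Sum>i<length bs. coord bs u i *s (bs ! i)) = (\<Sum>i<length bs. coord bs v i *s (bs ! i))"
    by (rule sum.cong) (simp_all add: assms(2))
  then show ?thesis
    by (simp only: coord_expand[OF assms(1)])
qed

text \<open>This is the matrix of \<open>A\<close> in the basis \<open>bs\<close>: each coordinate
  of \<open>A v\<close> is a linear form in those of \<open>v\<close>, with coefficients independent
  of \<open>v\<close>.\<close>

lemma coord_linear:
  assumes "ordered_basis bs" "Vector_Spaces.linear scale scale A"
  shows "coord bs (A v) j = (\<Sum>i<length bs. coord bs v i * coord bs (A (bs ! i)) j)"
proof -
  interpret A: Vector_Spaces.linear scale scale A by fact
  have "coord bs (A v) j = coord bs (A (\<Sum>i<length bs. coord bs v i *s (bs ! i))) j"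
    by (simp add: coord_expand[OF assms(1)])
  then show ?thesis
    by (simp add: A.sum A.scale coord_sum coord_scale assms(1))
qed

lemma polynomial_fun_coord_linear:
  assumes "ordered_basis bs" "Vector_Spaces.linear scale scale A"
  shows "polynomial_fun bs (\<lambda>v. coord bs (A v) j)"
proof -
  have "polynomial_fun bs (\<lambda>v. \<Sum>i<length bs. coord bs v i * coord bs (A (bs ! i)) j)"
    by (intro polynomial_fun_sum polynomial_fun_mult polynomial_fun_const polynomial_fun_coord) simp
  then show ?thesis
    by (simp only: coord_linear[OF assms, symmetric])
qed

section \<open>Polynomial functions, basic open sets and irreducibility\<close>

lemma polynomial_fun_diff:
  assumes "polynomial_fun bs f" "polynomial_fun bs g"
  shows "polynomial_fun bs (\<lambda>v. f v - g v)"
  using polynomial_fun_add[OF assms(1) polynomial_fun_mult[OF polynomial_fun_const[of _ "-1"] assms(2)]]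
  by simp

text \<open>By the Leibniz formula a determinant is a polynomial in its entries.\<close>

lemma polynomial_fun_det:
  assumes "\<And>i j. i < n \<Longrightarrow> j < n \<Longrightarrow> polynomial_fun bs (\<lambda>v. a v i j)"
  shows "polynomial_fun bs (\<lambda>v. det (mat n n (\<lambda>(i, j). a v i j)))"
proof -
  have "det (mat n n (\<lambda>(i, j). a v i j)) =
      (\<Sum>p\<in>{p. p permutes {0..<n}}. signof p * (\<Prod>i\<in>{0..<n}. a v i (p i)))" for v
    by (subst det_def'[of _ n]) (auto intro!: sum.cong prod.cong dest: permutes_in_image)
  moreover have "polynomial_fun bs
      (\<lambda>v. \<Sum>p\<in>{p. p permutes {0..<n}}. signof p * (\<Prod>i\<in>{0..<n}. a v i (p i)))"
    by (intro polynomial_fun_sum polynomial_fun_mult polynomial_fun_const polynomial_fun_prod assms)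
       (auto dest: permutes_in_image)
  ultimately show ?thesis by simp
qed

text \<open>The non-vanishing loci of single polynomial functions form a base of the topology, so
  openness can be checked with one function around each point.\<close>

lemma openin_zariski_iff_nonzero_nbhd:
  assumes "ordered_basis bs"
  shows "openin zariski_topology U \<longleftrightarrow>
    (\<forall>v\<in>U. \<exists>f. polynomial_fun bs f \<and> f v \<noteq> 0 \<and> (\<forall>w. f w \<noteq> 0 \<longrightarrow> w \<in> U))" (is "_ \<longleftrightarrow> ?R")
proof -
  have "openin zariski_topology U \<longleftrightarrow> closedin zariski_topology (- U)"
    by (simp add: openin_closedin_eq Compl_eq_Diff_UNIV)
  also have "\<dots> \<longleftrightarrow> (\<exists>F \<subseteq> Collect (polynomial_fun bs). - U = {v. \<forall>f \<in> F. f v = 0})"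
    by (simp add: closedin_zariski_topology_iff[OF assms] zariski_closed_wrt_iff_polynomial_fun)
  also have "\<dots> \<longleftrightarrow> ?R"
  proof
    assume "\<exists>F \<subseteq> Collect (polynomial_fun bs). - U = {v. \<forall>f \<in> F. f v = 0}"
    then obtain F where F: "F \<subseteq> Collect (polynomial_fun bs)" "- U = {v. \<forall>f \<in> F. f v = 0}"
      by blast
    show ?R
    proof
      fix v assume "v \<in> U"
      then obtain f where "f \<in> F" "f v \<noteq> 0" using F(2) by blast
      then show "\<exists>f. polynomial_fun bs f \<and> f v \<noteq> 0 \<and> (\<forall>w. f w \<noteq> 0 \<longrightarrow> w \<in> U)"
        using F by blast
    qed
  next
    assume R: ?R
    show "\<exists>F \<subseteq> Collect (polynomial_fun bs). - U = {v. \<forall>f \<in> F. f v = 0}"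
      \<comment> \<open>The family consists of all polynomial functions vanishing on the complement
        of \<open>U\<close>.\<close>
      by (rule exI[of _ "{f. polynomial_fun bs f \<and> (\<forall>w. f w \<noteq> 0 \<longrightarrow> w \<in> U)}"]) (use R in blast)
  qed
  finally show ?thesis .
qed

lemma polynomial_fun_on_line:
  assumes "ordered_basis bs" "polynomial_fun bs f"
  shows "\<exists>q. \<forall>t. f (u + t *s w) = poly q t"
proof -
  obtain p where p: "\<And>v. f v = mpoly_eval (coord bs v) p"
    using assms(2) unfolding polynomial_fun_def by blast
  \<comment> \<open>\<open>?l i\<close> is the \<open>i\<close>-th coordinate of the moving point
    \<open>u + t *s w\<close>, as a polynomial in \<open>t\<close>.\<close>
  let ?l = "\<lambda>i. [:coord bs u i, coord bs w i:]"
  let ?q = "\<Sum>m\<in>Poly_Mapping.keys p. Polynomial.smult (Poly_Mapping.lookup p m)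
      (\<Prod>i\<in>Poly_Mapping.keys m. ?l i ^ Poly_Mapping.lookup m i)"
  have "f (u + t *s w) = poly ?q t" for t
    unfolding p mpoly_eval_def mono_eval_def
    by (simp add: poly_sum poly_prod coord_add coord_scale assms(1))
  then show ?thesis by blast
qed

lemma zariski_irreducible:
  assumes bs: "ordered_basis bs" and inf: "infinite (UNIV :: 'a set)"
    and U: "openin zariski_topology U" "U \<noteq> {}"
    and W: "openin zariski_topology W" "W \<noteq> {}"
  shows "U \<inter> W \<noteq> {}"
proof -
  obtain u f where f: "polynomial_fun bs f" "f u \<noteq> 0" "\<And>v. f v \<noteq> 0 \<Longrightarrow> v \<in> U"
    using U unfolding openin_zariski_iff_nonzero_nbhd[OF bs] by blast
  obtain w g where g: "polynomial_fun bs g" "g w \<noteq> 0" "\<And>v. g v \<noteq> 0 \<Longrightarrow> v \<in> W"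
    using W unfolding openin_zariski_iff_nonzero_nbhd[OF bs] by blast
  obtain p where p: "\<And>t. f (u + t *s (w - u)) = poly p t"
    using polynomial_fun_on_line[OF bs f(1)] by blast
  obtain q where q: "\<And>t. g (u + t *s (w - u)) = poly q t"
    using polynomial_fun_on_line[OF bs g(1)] by blast
  \<comment> \<open>The line passes through \<open>u\<close> at parameter 0 and through
    \<open>w\<close> at parameter 1, so neither restriction vanishes identically.\<close>
  have "p \<noteq> 0" using p[of 0] f(2) by auto
  moreover have "q \<noteq> 0" using q[of 1] g(2) by auto
  ultimately have "finite {t. poly (p * q) t = 0}"
    by (intro poly_roots_finite) simp
  then obtain t where "poly (p * q) t \<noteq> 0"
    using inf by (metis (mono_tags, lifting) UNIV_eq_I mem_Collect_eq)
  then show ?thesis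
    using f(3)[of "u + t *s (w - u)"] g(3)[of "u + t *s (w - u)"] by (auto simp: p q)
qed

text \<open>Induction on the family: irreducibility lets each new member meet the non-empty open
  intersection of the others.\<close>

lemma zariski_finite_Inter:
  assumes "ordered_basis bs" "infinite (UNIV :: 'a set)" "finite K"
    and "\<And>U. U \<in> K \<Longrightarrow> openin zariski_topology U \<and> U \<noteq> {}"
  shows "openin zariski_topology (\<Inter>K) \<and> \<Inter>K \<noteq> {}"
  using assms(3,4)
proof (induction K rule: finite_induct)
  case empty
  then show ?case using openin_topspace[of zariski_topology] by simp
next
  case (insert U K)
  then have "openin zariski_topology U" "U \<noteq> {}"
      "openin zariski_topology (\<Inter>K)" "\<Inter>K \<noteq> {}"
    by auto
  then show ?case
    using zariski_irreducible[OF assms(1,2)] by (simp add: openin_Int)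
qed

end

section \<open>Generators and symmetries via minors\<close>

context kG_module
begin

section \<open>Bases inside an orbit and openness of the generators\<close>

lemma orbit_eq_image: "orbit G act v = (\<lambda>g. act g v) ` carrier G"
  unfolding orbit_def by blast

text \<open>A spanning orbit contains a basis, and invariance of dimension gives it the length of
  \<open>bs\<close>. Recording the group elements \<open>h r\<close> allows the same elements to be
  applied to other points \<open>w\<close>.\<close>

lemma basis_in_orbit:
  assumes "ordered_basis bs" "v \<in> Gens"
  obtains h where "\<And>r. r < length bs \<Longrightarrow> h r \<in> carrier G"
    and "ordered_basis (map (\<lambda>r. act (h r) v) [0..<length bs])"
proof -
  obtain B where B: "B \<subseteq> orbit G act v" "independent B" "orbit G act v \<subseteq> span B"
    by (rule maximal_independent_subset[of "orbit G act v"])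
  have sB: "span B = UNIV"
    using span_minimal[OF B(3) subspace_span] assms(2) unfolding Gens_def by auto
  have bs: "distinct bs" "independent (set bs)" "span (set bs) = UNIV"
    using assms(1) unfolding ordered_basis_def by auto
  have "card B = length bs"
    using dim_eq_card[of B UNIV] dim_eq_card[of "set bs" UNIV] bs B(2) sB
    by (simp add: distinct_card)
  moreover have "finite B"
    using independent_span_bound[of "set bs" B] bs B(2) by simp
  ultimately obtain cs where cs: "set cs = B" "distinct cs" "length cs = length bs"
    by (metis distinct_card finite_distinct_list)
  have "\<exists>g. r < length bs \<longrightarrow> g \<in> carrier G \<and> act g v = cs ! r" for r
  proof (cases "r < length bs")
    case True
    then have "cs ! r \<in> orbit G act v"
      using subsetD[OF B(1), of "cs ! r"] nth_mem[of r cs] by (simp add: cs)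
    then show ?thesis by (auto simp: orbit_def)
  qed simp
  then obtain h where h: "\<And>r. r < length bs \<Longrightarrow> h r \<in> carrier G \<and> act (h r) v = cs ! r"
    by metis
  have "map (\<lambda>r. act (h r) v) [0..<length bs] = cs"
    by (rule nth_equalityI) (use h cs in auto)
  then show thesis
    using that[of h] h cs B(2) sB by (simp add: ordered_basis_def)
qed

lemma openin_Gens:
  assumes bs: "ordered_basis bs"
  shows "openin zariski_topology Gens"
  unfolding openin_zariski_iff_nonzero_nbhd[OF bs]
proof
  fix v assume "v \<in> Gens"
  then obtain h where h: "\<And>r. r < length bs \<Longrightarrow> h r \<in> carrier G"
      "ordered_basis (map (\<lambda>r. act (h r) v) [0..<length bs])" (is "ordered_basis ?cs")
    using basis_in_orbit[OF bs] by blast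
  let ?n = "length bs"
  \<comment> \<open>With \<open>h\<close> fixed by \<open>v\<close>, this polynomial in
    \<open>w\<close> tests whether the vectors \<open>act (h r) w\<close> are independent.\<close>
  let ?f = "\<lambda>w. det (mat ?n ?n (\<lambda>(r, j). coord bs (act (h r) w) j))"
  have "polynomial_fun bs ?f"
    by (intro polynomial_fun_det polynomial_fun_coord_linear bs linear_act h)
  moreover have "?f v \<noteq> 0"
  proof
    assume "?f v = 0"
    then obtain c r where c: "r < ?n" "c r \<noteq> 0"
        "\<And>j. j < ?n \<Longrightarrow> (\<Sum>i<?n. c i * coord bs (act (h i) v) j) = 0"
      unfolding det_eq_0_iff_left_kernel by blast
    \<comment> \<open>A relation between rows of coordinates is a relation between the vectors
      themselves, contradicting that \<open>?cs\<close> is a basis.\<close>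
    have "(\<Sum>i<?n. scale (c i) (act (h i) v)) = 0"
      by (rule vector_eqI_coord[OF bs]) (simp add: coord_sum coord_scale coord_0 bs c(3))
    then have "coord ?cs (\<Sum>i<?n. scale (c i) (?cs ! i)) r = 0"
      by (simp add: coord_0 h(2))
    moreover have "coord ?cs (\<Sum>i<?n. scale (c i) (?cs ! i)) r = (\<Sum>i<?n. c i * (if i = r then 1 else 0))"
      unfolding coord_sum[OF h(2)] coord_scale[OF h(2)]
      by (intro sum.cong refl) (use c(1) in \<open>simp add: coord_basis[OF h(2)] del: nth_map_upt nth_map\<close>)
    ultimately show False
      using c(1,2) by (simp add: if_distrib sum.delta cong: if_cong)
  qed
  moreover have "w \<in> Gens" if w: "?f w \<noteq> 0" for w
  proof -
    obtain b where b: "\<And>i j. i < ?n \<Longrightarrow> j < ?n \<Longrightarrow>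
        (\<Sum>r<?n. b i r * coord bs (act (h r) w) j) = (if i = j then 1 else 0)"
      using left_inverse_if_det_neq_0[OF w] by blast
    have "bs ! i \<in> span (orbit G act w)" if i: "i < ?n" for i
    proof -
      \<comment> \<open>The left inverse expresses each basis vector through the orbit of
        \<open>w\<close>, so that orbit spans.\<close>
      have "bs ! i = (\<Sum>r<?n. scale (b i r) (act (h r) w))"
        by (rule vector_eqI_coord[OF bs])
           (simp add: coord_sum coord_scale coord_basis bs i b)
      then show ?thesis
        using h(1) by (simp add: orbit_eq_image) (intro span_sum span_scale span_base imageI, simp)
    qed
    then have "span (set bs) \<subseteq> span (orbit G act w)"
      by (intro span_minimal subspace_span) (auto simp: in_set_conv_nth)
    then show ?thesis
      using bs by (auto simp: Gens_def ordered_basis_def)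
  qed
  ultimately show "\<exists>f. polynomial_fun bs f \<and> f v \<noteq> 0 \<and> (\<forall>w. f w \<noteq> 0 \<longrightarrow> w \<in> Gens)"
    by blast
qed

section \<open>Symmetries at a generator and the openness of their failure\<close>

lemma Sym_atI:
  assumes bs: "ordered_basis bs" and v: "v \<in> Gens" and \<pi>: "\<pi> permutes carrier G"
    and A: "Vector_Spaces.linear scale scale A" "\<And>g. g \<in> carrier G \<Longrightarrow> A (act g v) = act (\<pi> g) v"
  shows "\<pi> \<in> Sym_at v"
proof -
  interpret A: Vector_Spaces.linear scale scale A by fact
  \<comment> \<open>Since \<pi> only reindexes the orbit, the image of \<open>A\<close> contains a
    spanning set; in finite dimension surjectivity then gives injectivity.\<close>
  have "A ` orbit G act v = (\<lambda>g. act g v) ` (\<pi> ` carrier G)"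
    using A(2) by (force simp: orbit_eq_image image_image)
  also have "\<dots> = orbit G act v"
    by (simp add: permutes_image[OF \<pi>] orbit_eq_image)
  finally have "surj A"
    using v A.span_image[of "orbit G act v"] by (simp add: Gens_def)
  interpret fd: finite_dimensional_vector_space scale "set bs"
    by unfold_locales (use bs in \<open>auto simp: ordered_basis_def\<close>)
  have "inj A"
    using fd.linear_surj_imp_inj A(1) \<open>surj A\<close> by blast
  then show ?thesis
    unfolding Sym_at_def using A \<pi> \<open>surj A\<close> by (auto simp: bij_def)
qed

text \<open>A linear map realising \<pi> at \<open>w\<close> makes the last column of the bordered
  matrix a combination of the others. At a generator where \<pi> fails, a suitable row and
  coordinate make the bordered determinant nonzero.\<close>

lemma openin_not_Sym_at:
  assumes bs: "ordered_basis bs" and \<pi>: "\<pi> permutes carrier G"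
  shows "openin zariski_topology {v \<in> Gens. \<pi> \<notin> Sym_at v}"
proof -
  have *: "\<exists>f. polynomial_fun bs f \<and> f v \<noteq> 0 \<and> (\<forall>w. f w \<noteq> 0 \<longrightarrow> \<pi> \<notin> Sym_at w)"
    if v: "v \<in> Gens" "\<pi> \<notin> Sym_at v" for v
  proof -
    obtain h where h: "\<And>r. r < length bs \<Longrightarrow> h r \<in> carrier G"
        "ordered_basis (map (\<lambda>r. act (h r) v) [0..<length bs])" (is "ordered_basis ?cs")
      using basis_in_orbit[OF bs v(1)] by blast
    let ?n = "length bs"
    have \<pi>_in: "\<pi> g \<in> carrier G" if "g \<in> carrier G" for g
      using permutes_in_image[OF \<pi>] that by blast
    \<comment> \<open>The only candidate for a linear map realising \<pi> at \<open>v\<close>: its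
      values on the basis \<open>?cs\<close> are forced.\<close>
    define A where "A x = (\<Sum>i<?n. scale (coord ?cs x i) (act (\<pi> (h i)) v))" for x
    have A_lin: "Vector_Spaces.linear scale scale A"
      by unfold_locales
         (simp_all add: A_def coord_add[OF h(2)] coord_scale[OF h(2)] scale_left_distrib
            scale_sum_right sum.distrib)
    interpret A: Vector_Spaces.linear scale scale A by (fact A_lin)
    have A_h: "A (act (h i) v) = act (\<pi> (h i)) v" if i: "i < ?n" for i
    proof -
      have "coord ?cs (act (h i) v) j = (if i = j then 1 else 0)" if "j < ?n" for j
        using coord_basis[OF h(2), of i j] i that by simp
      then show ?thesis
        using i unfolding A_def by (simp add: if_distrib[of "\<lambda>c. scale c _"] sum.delta cong: if_cong)
    qed
    obtain g where g: "g \<in> carrier G" "A (act g v) \<noteq> act (\<pi> g) v"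
      using Sym_atI[OF bs v(1) \<pi> A_lin] v(2) by blast
    obtain j where j: "j < ?n" "coord bs (A (act g v)) j \<noteq> coord bs (act (\<pi> g) v) j"
      using vector_eqI_coord[OF bs] g(2) by blast
    \<comment> \<open>Rows 0 to \<open>?n - 1\<close> belong to the basis elements; row
      \<open>?n\<close> belongs to the element \<open>g\<close> where the candidate fails.\<close>
    define k where "k r = (if r < ?n then h r else g)" for r
    have k: "k r \<in> carrier G" for r
      using h(1) g(1) by (simp add: k_def)
    \<comment> \<open>The first \<open>?n\<close> columns hold all coordinates of
      \<open>act (k r) w\<close>; column \<open>?n\<close> holds only coordinate \<open>j\<close>,
      where the failure at \<open>g\<close> shows.\<close>
    define a where
      "a w r c = (if c < ?n then coord bs (act (k r) w) c else coord bs (act (\<pi> (k r)) w) j)" for w r c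
    let ?f = "\<lambda>w. det (mat (Suc ?n) (Suc ?n) (\<lambda>(r, c). a w r c))"
    have "polynomial_fun bs (\<lambda>w. a w r c)" for r c
      by (cases "c < ?n") (simp_all add: a_def polynomial_fun_coord_linear bs linear_act k \<pi>_in)
    then have "polynomial_fun bs ?f"
      by (intro polynomial_fun_det)
    moreover have "?f v \<noteq> 0"
    proof
      assume "?f v = 0"
      then obtain c where c: "\<exists>r<Suc ?n. c r \<noteq> 0"
          "\<And>i. i < Suc ?n \<Longrightarrow> (\<Sum>r<Suc ?n. c r * a v r i) = 0"
        unfolding det_eq_0_iff_left_kernel by blast
      have rel: "(\<Sum>r<Suc ?n. scale (c r) (act (k r) v)) = 0"
      proof (rule vector_eqI_coord[OF bs])
        fix i assume "i < ?n"
        then show "coord bs (\<Sum>r<Suc ?n. scale (c r) (act (k r) v)) i = coord bs 0 i"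
          using c(2)[of i] by (simp add: coord_sum coord_scale coord_add coord_0 bs a_def)
      qed
      \<comment> \<open>Applying \<open>A\<close> to this relation and comparing with the last column isolates \<open>c ?n\<close>.\<close>
      have "(\<Sum>r<Suc ?n. scale (c r) (A (act (k r) v))) = 0"
        using arg_cong[OF rel, of A] by (simp only: A.sum A.scale A.zero)
      then have s1: "(\<Sum>r<Suc ?n. c r * coord bs (A (act (k r) v)) j) = 0"
        using coord_sum[OF bs, of "\<lambda>r. scale (c r) (A (act (k r) v))" "{..<Suc ?n}" j]
        by (simp only: coord_scale[OF bs] coord_0[OF bs])
      have s2: "(\<Sum>r<Suc ?n. c r * coord bs (act (\<pi> (k r)) v) j) = 0"
        using c(2)[of ?n] by (simp add: a_def)
      have s3: "(\<Sum>r<?n. c r * coord bs (A (act (k r) v)) j) =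
          (\<Sum>r<?n. c r * coord bs (act (\<pi> (k r)) v) j)"
        by (intro sum.cong refl) (simp add: k_def A_h)
      have "k ?n = g" by (simp add: k_def)
      then have "c ?n * coord bs (A (act g v)) j = c ?n * coord bs (act (\<pi> g) v) j"
        using s1 s2 unfolding sum.lessThan_Suc s3 by (metis add_left_cancel)
      then have cn: "c ?n = 0"
        using j(2) by simp
      \<comment> \<open>Without the last row, the relation involves only the basis
        \<open>?cs\<close>.\<close>
      have "c i = 0" if i: "i < ?n" for i
      proof -
        have "(\<Sum>r<?n. scale (c r) (?cs ! r)) = 0"
          using rel cn by (simp add: k_def)
        then have "0 = coord ?cs (\<Sum>r<?n. scale (c r) (?cs ! r)) i"
          by (simp only: coord_0[OF h(2)])
        also have "\<dots> = (\<Sum>r<?n. c r * coord ?cs (?cs ! r) i)"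
          by (simp only: coord_sum[OF h(2)] coord_scale[OF h(2)])
        also have "\<dots> = (\<Sum>r<?n. c r * (if r = i then 1 else 0))"
          by (intro sum.cong refl) (use i in \<open>simp add: coord_basis[OF h(2)] del: nth_map_upt nth_map\<close>)
        finally show ?thesis
          using i by (simp add: if_distrib sum.delta cong: if_cong)
      qed
      with cn c(1) show False
        by (auto simp: less_Suc_eq)
    qed
    moreover have "\<pi> \<notin> Sym_at w" if w: "?f w \<noteq> 0" for w
    proof
      assume "\<pi> \<in> Sym_at w"
      then obtain T where T: "Vector_Spaces.linear scale scale T"
          "\<And>g. g \<in> carrier G \<Longrightarrow> T (act g w) = act (\<pi> g) w"
        unfolding Sym_at_def by blast
      \<comment> \<open>The first entries give the linear form computing coordinate \<open>j\<close>
        of \<open>T\<close>; the entry -1 subtracts the last column, which has that same value in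
        every row.\<close>
      define c where "c i = (if i < ?n then coord bs (T (bs ! i)) j else -1)" for i
      have "\<forall>r<Suc ?n. (\<Sum>i<Suc ?n. a w r i * c i) = 0"
        using coord_linear[OF bs T(1), of "act (k _) w" j, symmetric]
        by (simp add: T(2) k a_def c_def)
      moreover have "\<exists>i<Suc ?n. c i \<noteq> 0"
        by (rule exI[of _ ?n]) (simp add: c_def)
      ultimately have "?f w = 0"
        unfolding det_eq_0_iff_right_kernel by (intro exI[of _ c] conjI)
      with w show False by contradiction
    qed
    ultimately show ?thesis by blast
  qed
  \<comment> \<open>This set is a union of basic open sets that avoid the symmetry \<pi>;
    intersecting it with \<open>Gens\<close> gives the set in question.\<close>
  have "openin zariski_topology {v. \<exists>f. polynomial_fun bs f \<and> f v \<noteq> 0 \<and>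
      (\<forall>w. f w \<noteq> 0 \<longrightarrow> \<pi> \<notin> Sym_at w)}" (is "openin _ ?U")
    unfolding openin_zariski_iff_nonzero_nbhd[OF bs]
  proof (intro ballI)
    fix v assume "v \<in> ?U"
    then obtain f where "polynomial_fun bs f" "f v \<noteq> 0" "\<forall>w. f w \<noteq> 0 \<longrightarrow> \<pi> \<notin> Sym_at w"
      by blast
    then show "\<exists>f. polynomial_fun bs f \<and> f v \<noteq> 0 \<and> (\<forall>w. f w \<noteq> 0 \<longrightarrow> w \<in> ?U)"
      by (intro exI[of _ f]) auto
  qed
  then have "openin zariski_topology (Gens \<inter> ?U)"
    by (rule openin_Int[OF openin_Gens[OF bs]])
  moreover have "Gens \<inter> ?U = {v \<in> Gens. \<pi> \<notin> Sym_at v}"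
    using * by blast
  ultimately show ?thesis by simp
qed

section \<open>Moved points and the assembly of the generic locus\<close>

lemma openin_not_fixed:
  assumes bs: "ordered_basis bs" and g: "g \<in> carrier G"
  shows "openin zariski_topology {v. act g v \<noteq> v}"
  unfolding openin_zariski_iff_nonzero_nbhd[OF bs]
proof
  fix v assume "v \<in> {v. act g v \<noteq> v}"
  then obtain j where j: "j < length bs" "coord bs (act g v) j \<noteq> coord bs v j"
    using vector_eqI_coord[OF bs] by blast
  let ?f = "\<lambda>w. coord bs (act g w) j - coord bs w j"
  have "polynomial_fun bs ?f"
    by (intro polynomial_fun_diff polynomial_fun_coord_linear polynomial_fun_coord linear_act bs g j)
  then show "\<exists>f. polynomial_fun bs f \<and> f v \<noteq> 0 \<and> (\<forall>w. f w \<noteq> 0 \<longrightarrow> w \<in> {v. act g v \<noteq> v})"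
    by (intro exI[of _ ?f]) (use j in auto)
qed

text \<open>\<open>Ker\<close> lies in every stabilizer and \<open>Sym\<close> in
  \<open>Sym_at v\<close> for every generator \<open>v\<close>. So each equality in the definition
  of generic says that no element outside the smaller set belongs to the larger one, one condition
  per element.\<close>

lemma generic_eq_Inter:
  "{v. generic v} = \<Inter> ({Gens} \<union> (\<lambda>g. {v. act g v \<noteq> v}) ` (carrier G - Ker) \<union>
    (\<lambda>\<pi>. {v \<in> Gens. \<pi> \<notin> Sym_at v}) ` ({\<pi>. \<pi> permutes carrier G} - Sym))"
proof -
  have "stabilizer G act v = Ker \<longleftrightarrow> (\<forall>g \<in> carrier G - Ker. act g v \<noteq> v)" for v
    by (auto simp: stabilizer_def Ker_def)
  moreover have "Sym_at v = Sym \<longleftrightarrow> (\<forall>\<pi> \<in> {\<pi>. \<pi> permutes carrier G} - Sym. \<pi> \<notin> Sym_at v)"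
    if "v \<in> Gens" for v
  proof -
    have "Sym \<subseteq> Sym_at v" "Sym_at v \<subseteq> {\<pi>. \<pi> permutes carrier G}"
      using that by (auto simp: Sym_def Sym_at_def)
    then show ?thesis by blast
  qed
  ultimately have "generic v \<longleftrightarrow> v \<in> Gens \<and> (\<forall>g \<in> carrier G - Ker. act g v \<noteq> v) \<and>
      (\<forall>\<pi> \<in> {\<pi>. \<pi> permutes carrier G} - Sym. \<pi> \<notin> Sym_at v)" for v
    unfolding generic_def by blast
  then show ?thesis
    by (simp only: Set.set_eq_iff Inter_iff ball_Un ball_simps Set.mem_Collect_eq) blast
qed

theorem generic_open_nonempty:
  assumes fin: "finite (carrier G)" and inf: "infinite (UNIV :: 'k set)" and cyclic
  shows "{v. generic v} \<noteq> {} \<and> openin zariski_topology {v. generic v}"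
proof -
  obtain bs where bs: "ordered_basis bs"
    using ordered_basis_exists[OF fin \<open>cyclic\<close>] by blast
  \<comment> \<open>An element outside \<open>Ker\<close> moves some vector, and a permutation
    outside \<open>Sym\<close> fails at some generator, so no member is empty.\<close>
  have U: "openin zariski_topology U \<and> U \<noteq> {}"
    if "U \<in> {Gens} \<union> (\<lambda>g. {v. act g v \<noteq> v}) ` (carrier G - Ker) \<union>
      (\<lambda>\<pi>. {v \<in> Gens. \<pi> \<notin> Sym_at v}) ` ({\<pi>. \<pi> permutes carrier G} - Sym)" for U
    using that \<open>cyclic\<close> openin_Gens[OF bs] openin_not_fixed[OF bs] openin_not_Sym_at[OF bs]
    by (auto simp: cyclic_def Ker_def Sym_def)
  \<comment> \<open>The family is finite because a finite group has finitely many elements and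
    finitely many permutations of its carrier.\<close>
  have "openin zariski_topology {v. generic v} \<and> {v. generic v} \<noteq> {}"
    unfolding generic_eq_Inter
    by (rule zariski_finite_Inter[OF bs inf _ U]) (use fin in \<open>auto simp: finite_permutations\<close>)
  then show ?thesis by blast
qed

end

theorem theorem2p15:
  fixes G :: "('g, 'm) monoid_scheme"
    and scale :: "'k::field \<Rightarrow> 'v::ab_group_add \<Rightarrow> 'v"
    and act :: "'g \<Rightarrow> 'v \<Rightarrow> 'v"
  assumes "kG_module G scale act"
    and "finite (carrier G)"
    and "infinite (UNIV :: 'k set)"
    and "kG_module.cyclic G scale act"
  shows "{v. kG_module.generic G scale act v} \<noteq> {} \<and>
    openin (zariski_vector_space.zariski_topology scale) {v. kG_module.generic G scale act v}"
  using kG_module.generic_open_nonempty[OF assms] .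

end
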